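(* Let $r$ be a positive integer. Up to translation and rotation by $180$ degrees, there are exactly $\lceil\frac{r+1}{2}\rceil$ different maximal anticodes of diameter $r$ in the hexagonal grid (with hexagonal distance), namely the sets $\mathcal{A}_0,\mathcal{A}_1,\ldots,\mathcal{A}_{\lceil\frac{r-1}{2}\rceil}$, where \[ \mathcal{A}_i=\{(x,y)\in\mathbb{Z}^2 : 0\le x\le r,\ 0\le y\le r,\ x-i\le y\le x-i+r\}. \]
   Context: Represent the hexagonal grid by $\mathbb{Z}^2$, where $(x,y)$ has neighbours $(x\pm1,y)$, $(x,y\pm1)$, $(x+1,y+1)$, $(x-1,y-1)$ (this is the adjacency graph of a tiling of the plane by regular hexagons, under the identification of $(x,y)$ with the plane point $x(1,0)+y(-\tfrac12,\tfrac{\sqrt3}{2})$). The hexagonal distance between two points is the graph distance in this graph. An anticode of diameter $r$ is a set $S$ of grid points with pairwise hexagonal distances at most $r$; it is maximal if $S\cup\{p\}$ has diameter greater than $r$ for every grid point $p\notin S$. *)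

theory Defs
  imports Complex_Main "HOL-Library.Product_Plus" "HOL-Library.Extended_Nat"
begin

definition hex_adj :: "int \<times> int \<Rightarrow> int \<times> int \<Rightarrow> bool" where
  "hex_adj p q \<longleftrightarrow> q - p \<in> {(1, 0), (-1, 0), (0, 1), (0, -1), (1, 1), (-1, -1)}"

text \<open>Graph distance: the least length of a walk. The grid is connected (see
  \<open>hex_connected\<close> below), so the minimum is always attained.\<close>

definition hex_dist :: "int \<times> int \<Rightarrow> int \<times> int \<Rightarrow> nat" where
  "hex_dist p q = (LEAST n. (hex_adj ^^ n) p q)"

definition hex_diameter :: "(int \<times> int) set \<Rightarrow> enat" where
  "hex_diameter S = (SUP p\<in>S. SUP q\<in>S. enat (hex_dist p q))"

definition anticode :: "nat \<Rightarrow> (int \<times> int) set \<Rightarrow> bool" where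
  "anticode r S \<longleftrightarrow> (\<forall>p\<in>S. \<forall>q\<in>S. hex_dist p q \<le> r)"

definition maximal_anticode :: "nat \<Rightarrow> (int \<times> int) set \<Rightarrow> bool" where
  "maximal_anticode r S \<longleftrightarrow>
     anticode r S \<and> (\<forall>p. p \<notin> S \<longrightarrow> hex_diameter (insert p S) > enat r)"

text \<open>The embedding of the grid into the plane is linear, so the rotation by 180 degrees about
  the origin is \<open>p \<mapsto> - p\<close>. The maps generated by it and the grid
  translations are exactly \<open>p \<mapsto> p + v\<close> and \<open>p \<mapsto> - p + v\<close>; this includes the half-turns about
  every other centre that preserve the grid.\<close>

definition hex_congruent :: "((int \<times> int) set \<times> (int \<times> int) set) set" where
  "hex_congruent =
     {(S, T). \<exists>v. T = (\<lambda>p. p + v) ` S \<or> T = (\<lambda>p. - p + v) ` S}"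

definition hex_A :: "nat \<Rightarrow> nat \<Rightarrow> (int \<times> int) set" where
  "hex_A r i = {(x, y). 0 \<le> x \<and> x \<le> int r \<and> 0 \<le> y \<and> y \<le> int r \<and>
                        x - int i \<le> y \<and> y \<le> x - int i + int r}"

lemma equiv_hex_congruent: "equiv UNIV hex_congruent"
proof (rule equivI)
  show "refl hex_congruent"
  proof (rule refl_onI)
    fix S :: "(int \<times> int) set"
    have "S = (\<lambda>p. p + 0) ` S" by simp
    then show "(S, S) \<in> hex_congruent" unfolding hex_congruent_def by blast
  qed
  show "sym hex_congruent"
  proof (rule symI)
    fix S T assume "(S, T) \<in> hex_congruent"
    then obtain v where "T = (\<lambda>p. p + v) ` S \<or> T = (\<lambda>p. - p + v) ` S"
      unfolding hex_congruent_def by blast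
    then have "S = (\<lambda>p. p + (- v)) ` T \<or> S = (\<lambda>p. - p + v) ` T"
      by (elim disjE; simp add: image_image)
    then show "(T, S) \<in> hex_congruent" unfolding hex_congruent_def by blast
  qed
  show "trans hex_congruent"
  proof (rule transI)
    fix S T U assume "(S, T) \<in> hex_congruent" "(T, U) \<in> hex_congruent"
    then obtain v w where
      "T = (\<lambda>p. p + v) ` S \<or> T = (\<lambda>p. - p + v) ` S"
      "U = (\<lambda>p. p + w) ` T \<or> U = (\<lambda>p. - p + w) ` T"
      unfolding hex_congruent_def by blast
    then have "U = (\<lambda>p. p + (v + w)) ` S \<or> U = (\<lambda>p. - p + (v + w)) ` S \<or>
               U = (\<lambda>p. - p + (w - v)) ` S \<or> U = (\<lambda>p. p + (w - v)) ` S"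
      by (elim disjE; simp add: image_image algebra_simps)
    then show "(S, U) \<in> hex_congruent" unfolding hex_congruent_def by blast
  qed
qed simp_all

lemma hex_connected: "\<exists>n. (hex_adj ^^ n) p q"
proof -
  have step: "hex_adj\<^sup>*\<^sup>* p (p + (s * int n, t * int n))"
    if "(s, t) \<in> {(1, 0), (-1, 0), (0, 1), (0, -1)}" for p s t n
  proof (induction n)
    case 0
    show ?case by (simp add: zero_prod_def[symmetric])
  next
    case (Suc n)
    have "hex_adj (p + (s * int n, t * int n)) (p + (s * int (Suc n), t * int (Suc n)))"
      using that unfolding hex_adj_def by (cases p) (auto simp: distrib_left)
    with Suc show ?case by simp
  qed
  have x: "hex_adj\<^sup>*\<^sup>* p (p + (a, 0))" for p a
    using step[of 1 0 p "nat a"] step[of "-1" 0 p "nat (- a)"] by (cases "a \<ge> 0") auto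
  have y: "hex_adj\<^sup>*\<^sup>* p (p + (0, b))" for p b
    using step[of 0 1 p "nat b"] step[of 0 "-1" p "nat (- b)"] by (cases "b \<ge> 0") auto
  have "p + (fst q - fst p, 0) + (0, snd q - snd p) = q"
    by (cases p, cases q) simp
  with rtranclp_trans[OF x y, of p "fst q - fst p" "snd q - snd p"]
  have "hex_adj\<^sup>*\<^sup>* p q" by simp
  then show ?thesis by (simp add: rtranclp_power)
qed

end

theory Submission
  imports Defs
begin

text \<open>The distance from \<open>p\<close> to \<open>q\<close> is the largest of \<open>|\<Delta>x|\<close>, \<open>|\<Delta>y|\<close>, \<open>|\<Delta>y - \<Delta>x|\<close>, so an anticode of
  diameter \<open>r\<close> is a set on which each of the three functionals \<open>x\<close>, \<open>y\<close>, \<open>y - x\<close> varies by at most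
  \<open>r\<close>. Starting from the three minima, such a set lies in the intersection of three strips of width
  \<open>r\<close>, which is itself an anticode; a maximal anticode therefore equals it. After translation this
  is \<open>\<A>\<^sub>i\<close> for some integer \<open>i\<close>, and \<open>0 \<le> i \<le> r\<close> because the minima of \<open>x\<close> and \<open>y\<close> are attained.
  The half-turn exchanges \<open>\<A>\<^sub>i\<close> and \<open>\<A>\<^sub>r\<^sub>-\<^sub>i\<close>, and there are no further coincidences.\<close>

text \<open>One edge changes each of the three functionals by at most 1.\<close>

lemma relpowp_hex_adj_bound:
  assumes "(hex_adj ^^ n) p q"
  shows "\<bar>fst q - fst p\<bar> \<le> int n \<and> \<bar>snd q - snd p\<bar> \<le> int n \<and>
         \<bar>(snd q - snd p) - (fst q - fst p)\<bar> \<le> int n"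
  using assms
proof (induction n arbitrary: q)
  case 0
  then show ?case by simp
next
  case (Suc n)
  then obtain z where z: "(hex_adj ^^ n) p z" "hex_adj z q" by auto
  show ?case using Suc.IH[OF z(1)] z(2)
    by (cases p, cases q, cases z) (auto simp: hex_adj_def)
qed

lemma hex_adj_step_closer:
  assumes "\<bar>fst q - fst p\<bar> \<le> int (Suc n)" "\<bar>snd q - snd p\<bar> \<le> int (Suc n)"
    "\<bar>(snd q - snd p) - (fst q - fst p)\<bar> \<le> int (Suc n)" "p \<noteq> q"
  shows "\<exists>z. hex_adj p z \<and> \<bar>fst q - fst z\<bar> \<le> int n \<and> \<bar>snd q - snd z\<bar> \<le> int n \<and>
         \<bar>(snd q - snd z) - (fst q - fst z)\<bar> \<le> int n"
proof -
  obtain a b c d where pq: "p = (a, b)" "q = (c, d)" by (cases p, cases q)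
  \<comment> \<open>The diagonal step leaves the third functional unchanged, but for differences of
    equal sign and size between 1 and \<open>n + 1\<close> it is already at most \<open>n\<close> in
    size. For opposite signs the step in x shrinks the third functional, and
    \<open>\<bar>\<Delta>y\<bar>\<close> is already at most \<open>n\<close>.\<close>
  define s :: "int \<times> int" where
    "s = (if a < c \<and> b < d then (1, 1) else if c < a \<and> d < b then (-1, -1)
          else if a < c then (1, 0) else if c < a then (-1, 0)
          else if b < d then (0, 1) else (0, -1))"
  have "hex_adj p (p + s)"
    by (auto simp: hex_adj_def s_def pq)
  moreover have "\<bar>fst q - fst (p + s)\<bar> \<le> int n \<and> \<bar>snd q - snd (p + s)\<bar> \<le> int n \<and>
         \<bar>(snd q - snd (p + s)) - (fst q - fst (p + s))\<bar> \<le> int n"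
    using assms by (auto simp: pq s_def)
  ultimately show ?thesis by blast
qed

lemma hex_dist_le_iff:
  "hex_dist p q \<le> n \<longleftrightarrow>
     \<bar>fst q - fst p\<bar> \<le> int n \<and> \<bar>snd q - snd p\<bar> \<le> int n \<and>
     \<bar>(snd q - snd p) - (fst q - fst p)\<bar> \<le> int n"
proof
  assume "hex_dist p q \<le> n"
  moreover have "(hex_adj ^^ hex_dist p q) p q"
    unfolding hex_dist_def using hex_connected by (rule LeastI_ex)
  ultimately show "\<bar>fst q - fst p\<bar> \<le> int n \<and> \<bar>snd q - snd p\<bar> \<le> int n \<and>
     \<bar>(snd q - snd p) - (fst q - fst p)\<bar> \<le> int n"
    using relpowp_hex_adj_bound[of "hex_dist p q" p q] by linarith
next
  assume "\<bar>fst q - fst p\<bar> \<le> int n \<and> \<bar>snd q - snd p\<bar> \<le> int n \<and>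
     \<bar>(snd q - snd p) - (fst q - fst p)\<bar> \<le> int n"
  \<comment> \<open>Length exactly \<open>n\<close> would be false: no walk of length 1 joins a
    point to itself.\<close>
  then have "\<exists>m\<le>n. (hex_adj ^^ m) p q"
  proof (induction n arbitrary: p)
    case 0
    then show ?case by (auto simp: prod_eq_iff)
  next
    case (Suc n)
    show ?case
    proof (cases "p = q")
      case True
      then have "(hex_adj ^^ 0) p q" by simp
      then show ?thesis by blast
    next
      case False
      with Suc.prems hex_adj_step_closer obtain z where "hex_adj p z"
        "\<bar>fst q - fst z\<bar> \<le> int n \<and> \<bar>snd q - snd z\<bar> \<le> int n \<and>
         \<bar>(snd q - snd z) - (fst q - fst z)\<bar> \<le> int n"
        by blast
      with Suc.IH show ?thesis by (meson Suc_le_mono relpowp_Suc_I2)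
    qed
  qed
  then show "hex_dist p q \<le> n"
    unfolding hex_dist_def by (meson Least_le le_trans)
qed

lemma hex_diameter_le_iff: "hex_diameter S \<le> enat r \<longleftrightarrow> anticode r S"
  by (simp add: hex_diameter_def anticode_def SUP_le_iff)

lemma maximal_anticode_iff:
  "maximal_anticode r S \<longleftrightarrow> anticode r S \<and> (\<forall>p. p \<notin> S \<longrightarrow> \<not> anticode r (insert p S))"
  by (simp add: maximal_anticode_def not_le[symmetric] hex_diameter_le_iff)

lemma anticode_subset: "anticode r T \<Longrightarrow> S \<subseteq> T \<Longrightarrow> anticode r S"
  by (auto simp: anticode_def)

text \<open>Maximality only tests adding one point, but a point of \<open>T\<close> outside
  \<open>S\<close> would already extend \<open>S\<close> inside the anticode
  \<open>T\<close>.\<close>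

lemma maximal_anticode_eqI:
  assumes "maximal_anticode r S" "anticode r T" "S \<subseteq> T"
  shows "S = T"
proof (rule equalityI[OF assms(3) subsetI], rule ccontr)
  fix p assume "p \<in> T" "p \<notin> S"
  moreover from this assms have "anticode r (insert p S)"
    by (intro anticode_subset[OF assms(2)]) auto
  ultimately show False using assms(1) by (auto simp only: maximal_anticode_iff)
qed

lemma maximal_anticode_nonempty:
  assumes "maximal_anticode r S"
  shows "S \<noteq> {}"
proof
  assume "S = {}"
  moreover have "anticode r {0}" by (simp add: anticode_def hex_dist_le_iff)
  ultimately show False using assms unfolding maximal_anticode_iff by blast
qed

lemma mem_hex_A:
  "(x, y) \<in> hex_A r i \<longleftrightarrow> 0 \<le> x \<and> x \<le> int r \<and> 0 \<le> y \<and> y \<le> int r \<and>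
     x - int i \<le> y \<and> y \<le> x - int i + int r"
  by (simp add: hex_A_def)

text \<open>Each of the six sides of \<open>\<A>\<^sub>i\<close> contains one of the corners \<open>(0,0)\<close>, \<open>(r,r)\<close>, \<open>(i,0)\<close>,
  \<open>(0,r-i)\<close>, and a point beyond a side is too far from the corner on the opposite side.\<close>

lemma maximal_anticode_hex_A:
  assumes "i \<le> r"
  shows "maximal_anticode r (hex_A r i)"
  unfolding maximal_anticode_iff
proof (intro conjI allI impI notI)
  show "anticode r (hex_A r i)"
    by (auto simp: anticode_def hex_dist_le_iff hex_A_def)
next
  fix p assume p: "p \<notin> hex_A r i" and a: "anticode r (insert p (hex_A r i))"
  obtain x y where xy: "p = (x, y)" by (cases p)
  have "(0, 0) \<in> hex_A r i" "(int r, int r) \<in> hex_A r i"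
    "(int i, 0) \<in> hex_A r i" "(0, int r - int i) \<in> hex_A r i"
    using assms by (simp_all add: mem_hex_A)
  with a have "hex_dist p (0, 0) \<le> r" "hex_dist p (int r, int r) \<le> r"
    "hex_dist p (int i, 0) \<le> r" "hex_dist p (0, int r - int i) \<le> r"
    by (simp_all add: anticode_def)
  then have "p \<in> hex_A r i" by (simp add: hex_dist_le_iff mem_hex_A xy abs_le_iff)
  with p show False ..
qed

text \<open>The minimum exists because the values of \<open>f\<close> are integers confined to a
  bounded interval.\<close>

lemma bounded_spread_attains_min:
  fixes f :: "'a \<Rightarrow> int"
  assumes "S \<noteq> {}" "\<And>p q. p \<in> S \<Longrightarrow> q \<in> S \<Longrightarrow> \<bar>f q - f p\<bar> \<le> k"
  obtains p where "p \<in> S" "\<And>q. q \<in> S \<Longrightarrow> f p \<le> f q \<and> f q \<le> f p + k"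
proof -
  obtain p0 where "p0 \<in> S" using assms(1) by blast
  then have "f ` S \<subseteq> {f p0 - k..f p0 + k}" using assms(2) by fastforce
  then have fin: "finite (f ` S)" by (rule finite_subset) simp
  then have "Min (f ` S) \<in> f ` S" using assms(1) by (intro Min_in) auto
  then obtain p where p: "p \<in> S" "f p = Min (f ` S)" by auto
  have "f p \<le> f q \<and> f q \<le> f p + k" if "q \<in> S" for q
    using that p fin assms(2)[OF p(1) that] by auto
  with p(1) show ?thesis by (rule that)
qed

lemma maximal_anticode_is_translate:
  assumes "maximal_anticode r S"
  obtains i v where "i \<le> r" "hex_A r i = (\<lambda>p. p + v) ` S"
proof -
  have ne: "S \<noteq> {}" using assms by (rule maximal_anticode_nonempty)
  have "\<And>p q. p \<in> S \<Longrightarrow> q \<in> S \<Longrightarrow> hex_dist p q \<le> r"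
    using assms by (simp add: maximal_anticode_iff anticode_def)
  note d = this[unfolded hex_dist_le_iff]
  obtain p where p: "p \<in> S" "\<And>q. q \<in> S \<Longrightarrow> fst p \<le> fst q \<and> fst q \<le> fst p + int r"
    using bounded_spread_attains_min[OF ne, of fst "int r"] d by blast
  obtain p' where p': "p' \<in> S" "\<And>q. q \<in> S \<Longrightarrow> snd p' \<le> snd q \<and> snd q \<le> snd p' + int r"
    using bounded_spread_attains_min[OF ne, of snd "int r"] d by blast
  have "\<bar>(snd q - fst q) - (snd p - fst p)\<bar> \<le> int r" if "p \<in> S" "q \<in> S" for p q
    using d[OF that] by linarith
  then obtain p'' where p'': "p'' \<in> S"
    "\<And>q. q \<in> S \<Longrightarrow> snd p'' - fst p'' \<le> snd q - fst q \<and> snd q - fst q \<le> snd p'' - fst p'' + int r"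
    using bounded_spread_attains_min[OF ne, of "\<lambda>q. snd q - fst q" "int r"] by blast
  define a b c where "a = fst p" and "b = snd p'" and "c = snd p'' - fst p''"
  define H where "H = {(x, y). a \<le> x \<and> x \<le> a + int r \<and> b \<le> y \<and> y \<le> b + int r \<and>
    c \<le> y - x \<and> y - x \<le> c + int r}"
  have "S \<subseteq> H"
    using p(2) p'(2) p''(2) by (auto simp: H_def a_def b_def c_def)
  moreover have "anticode r H" by (auto simp: anticode_def hex_dist_le_iff H_def)
  ultimately have SH: "S = H" using assms by (intro maximal_anticode_eqI)
  \<comment> \<open>Moving \<open>(a, b)\<close> to the origin turns the lower bound
    \<open>c\<close> of \<open>y - x\<close> into \<open>c - b + a\<close>, which has to be
    \<open>- i\<close>.\<close>
  define i where "i = nat (b - a - c)"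
  \<comment> \<open>At \<open>p'\<close> one has \<open>y = b\<close>, \<open>x \<ge> a\<close> and
    \<open>y - x \<ge> c\<close>. The upper bound follows likewise at \<open>p\<close>, where
    \<open>x = a\<close>, \<open>y \<ge> b\<close> and \<open>y - x \<le> c + r\<close>.\<close>
  have "b - a - c \<ge> 0" using p'(1) by (auto simp: SH H_def b_def)
  moreover have "b - a - c \<le> int r" using p(1) by (auto simp: SH H_def a_def)
  ultimately have i: "int i = b - a - c" "i \<le> r" by (auto simp: i_def)
  have "q \<in> hex_A r i \<longleftrightarrow> q - (- a, - b) \<in> S" for q
    by (cases q) (auto simp: mem_hex_A SH H_def i(1))
  then have "hex_A r i = (\<lambda>p. p + (- a, - b)) ` S"
    by (force simp: image_iff intro: bexI[of _ "_ - (- a, - b)"])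
  with i(2) show ?thesis by (rule that)
qed

text \<open>The half-turn about the centre of the square negates \<open>y - x\<close>, taking its
  range from \<open>- i\<close> to \<open>r - i\<close> into the range from \<open>i - r\<close> to
  \<open>i\<close>.\<close>

lemma hex_A_half_turn:
  assumes "i \<le> r"
  shows "hex_A r (r - i) = (\<lambda>p. - p + (int r, int r)) ` hex_A r i"
proof -
  have "q \<in> hex_A r (r - i) \<longleftrightarrow> - q + (int r, int r) \<in> hex_A r i" for q
    using assms by (cases q) (auto simp: mem_hex_A)
  then show ?thesis
    by (force simp: image_iff intro: bexI[of _ "- _ + (int r, int r)"])
qed

text \<open>The corners \<open>(0, 0)\<close> and \<open>(r, r)\<close> stay in the square only if
  \<open>v = 0\<close>; then \<open>(i, 0)\<close> gives \<open>i \<le> j\<close> and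
  \<open>(0, r - i)\<close> gives \<open>j \<le> i\<close>.\<close>

lemma hex_A_translate_eq:
  assumes "i \<le> r" "j \<le> r" "hex_A r j = (\<lambda>p. p + v) ` hex_A r i"
  shows "i = j"
proof -
  obtain a b where v: "v = (a, b)" by (cases v)
  have m: "p + v \<in> hex_A r j" if "p \<in> hex_A r i" for p
    using that assms(3) by blast
  have "(0, 0) \<in> hex_A r i" "(int r, int r) \<in> hex_A r i"
    "(int i, 0) \<in> hex_A r i" "(0, int r - int i) \<in> hex_A r i"
    using assms by (simp_all add: mem_hex_A)
  from this[THEN m] show ?thesis by (simp add: v mem_hex_A)
qed

lemma hex_A_congruent_iff:
  assumes "i \<le> r div 2" "j \<le> r div 2"
  shows "(hex_A r i, hex_A r j) \<in> hex_congruent \<longleftrightarrow> i = j"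
proof
  assume "(hex_A r i, hex_A r j) \<in> hex_congruent"
  then obtain v where
    "hex_A r j = (\<lambda>p. p + v) ` hex_A r i \<or> hex_A r j = (\<lambda>p. - p + v) ` hex_A r i"
    by (auto simp: hex_congruent_def)
  then show "i = j"
  proof
    assume "hex_A r j = (\<lambda>p. p + v) ` hex_A r i"
    then show ?thesis using assms by (intro hex_A_translate_eq) auto
  next
    assume "hex_A r j = (\<lambda>p. - p + v) ` hex_A r i"
    then have "hex_A r j = (\<lambda>p. p + (v - (int r, int r))) ` hex_A r (r - i)"
      using assms by (simp add: hex_A_half_turn image_image)
    \<comment> \<open>As both indices are at most \<open>r div 2\<close>, \<open>i + j = r\<close>
      forces \<open>i = j\<close>, with \<open>r\<close> even: the set that the half-turn
      fixes.\<close>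
    then have "r - i = j" using assms by (intro hex_A_translate_eq) auto
    then show ?thesis using assms by linarith
  qed
next
  assume "i = j"
  then show "(hex_A r i, hex_A r j) \<in> hex_congruent"
    using equiv_hex_congruent by (simp add: equiv_def refl_on_def)
qed

lemma maximal_anticode_congruent_hex_A:
  assumes "maximal_anticode r S"
  obtains i where "i \<le> r div 2" "(S, hex_A r i) \<in> hex_congruent"
proof -
  obtain i v where i: "i \<le> r" "hex_A r i = (\<lambda>p. p + v) ` S"
    using assms by (rule maximal_anticode_is_translate)
  then have S: "(S, hex_A r i) \<in> hex_congruent" unfolding hex_congruent_def by blast
  show ?thesis
  proof (cases "i \<le> r div 2")
    case True
    then show ?thesis using S that by blast
  next
    case False
    then have "r - i \<le> r div 2" by linarith
    moreover have "(hex_A r i, hex_A r (r - i)) \<in> hex_congruent"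
      using hex_A_half_turn[OF i(1)] unfolding hex_congruent_def by blast
    then have "(S, hex_A r (r - i)) \<in> hex_congruent"
      using S equiv_hex_congruent by (meson equivE transE)
    ultimately show ?thesis by (rule that)
  qed
qed

theorem theorem3:
  fixes r :: nat
  assumes "r > 0"
  shows "card ({S. maximal_anticode r S} // hex_congruent) = nat \<lceil>(real r + 1) / 2\<rceil> \<and>
         (\<forall>i \<in> {0..nat \<lceil>(real r - 1) / 2\<rceil>}. maximal_anticode r (hex_A r i)) \<and>
         (\<forall>S. maximal_anticode r S \<longrightarrow>
            (\<exists>!i. i \<in> {0..nat \<lceil>(real r - 1) / 2\<rceil>} \<and> (S, hex_A r i) \<in> hex_congruent))"
proof -
  \<comment> \<open>For either parity the index range is \<open>0\<close> to \<open>r div 2\<close>,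
    one representative from each pair \<open>i\<close>, \<open>r - i\<close>.\<close>
  have "\<lceil>(real r - 1) / 2\<rceil> = int (r div 2)" "\<lceil>(real r + 1) / 2\<rceil> = int (Suc (r div 2))"
    by (cases "even r"; auto simp: ceiling_unique elim!: evenE oddE)+
  then have m: "nat \<lceil>(real r - 1) / 2\<rceil> = r div 2" "nat \<lceil>(real r + 1) / 2\<rceil> = Suc (r div 2)"
    by simp_all
  have max: "maximal_anticode r (hex_A r i)" if "i \<le> r div 2" for i
    using that by (intro maximal_anticode_hex_A) simp
  let ?cls = "\<lambda>i. hex_congruent `` {hex_A r i}"
  have "{S. maximal_anticode r S} // hex_congruent = ?cls ` {0..r div 2}"
  proof (intro equalityI subsetI)
    fix X assume "X \<in> {S. maximal_anticode r S} // hex_congruent"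
    then obtain S where S: "maximal_anticode r S" "X = hex_congruent `` {S}"
      by (auto elim: quotientE)
    obtain i where "i \<le> r div 2" "(S, hex_A r i) \<in> hex_congruent"
      using S(1) by (rule maximal_anticode_congruent_hex_A)
    then show "X \<in> ?cls ` {0..r div 2}"
      using S(2) equiv_class_eq[OF equiv_hex_congruent] by auto
  next
    fix X assume "X \<in> ?cls ` {0..r div 2}"
    then show "X \<in> {S. maximal_anticode r S} // hex_congruent"
      using max by (auto intro: quotientI)
  qed
  moreover have "inj_on ?cls {0..r div 2}"
    by (rule inj_onI)
      (simp add: eq_equiv_class_iff[OF equiv_hex_congruent] hex_A_congruent_iff)
  ultimately have "card ({S. maximal_anticode r S} // hex_congruent) = Suc (r div 2)"
    by (simp add: card_image)
  moreover have "\<exists>!i. i \<in> {0..r div 2} \<and> (S, hex_A r i) \<in> hex_congruent"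
    if S: "maximal_anticode r S" for S
  proof -
    obtain i where i: "i \<le> r div 2" "(S, hex_A r i) \<in> hex_congruent"
      using S by (rule maximal_anticode_congruent_hex_A)
    have "j = i" if "j \<le> r div 2" "(S, hex_A r j) \<in> hex_congruent" for j
    proof -
      have "(hex_A r j, hex_A r i) \<in> hex_congruent"
        using that(2) i(2) equiv_hex_congruent by (meson equivE symE transE)
      then show ?thesis using that(1) i(1) by (simp add: hex_A_congruent_iff)
    qed
    with i show ?thesis by auto
  qed
  ultimately show ?thesis unfolding m using max by auto
qed

end
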